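(* Let $\alpha>-\frac12$. For all $f\in\mathcal{E}_q(\mathbb{R}_q)$ and all $x\in\mathbb{R}_q$, $$V_{\alpha,q}(f)(x)=R_{\alpha,q}(f_e)(x)+\partial_q\big[R_{\alpha,q}I_q(f_o)\big](x),$$ where $I_q(f_o)(x)=\int_0^{|qx|}f_o(t)\,d_qt$ for $x\in\mathbb{R}_q$.
   Context: Standing assumptions: $q\in(0,1)$ and $\frac{\log(1-q)}{\log q}\in 2\mathbb{Z}$. Functions are complex-valued. $\mathbb{R}_q=\{\pm q^n: n\in\mathbb{Z}\}$; $f_e,f_o$ are the even and odd parts of $f$. Notation: $(a;q)_\infty=\prod_{k\ge0}(1-aq^k)$, $\Gamma_{q^2}(x)=\frac{(q^2;q^2)_\infty}{(q^{2x};q^2)_\infty}(1-q^2)^{1-x}$. $q$-Jackson integrals: $\int_0^af(x)d_qx=(1-q)a\sum_{n\ge0}q^nf(aq^n)$, $\int_{-1}^1h(t)d_qt=(1-q)\sum_{n\ge0}q^n[h(q^n)+h(-q^n)]$. For $z\neq0$, $\partial_q f(z)=\frac{f(q^{-1}z)+f(-q^{-1}z)-f(qz)+f(-qz)-2f(-z)}{2(1-q)z}$. $\mathcal{E}_q(\mathbb{R}_q)$ is the space of functions $f$ on $\mathbb{R}_q$ such that for all $n\in\mathbb{N}$, $a\ge0$, $\sup\{|\partial_q^kf(x)|:0\le k\le n,\ x\in[-a,a]\cap\mathbb{R}_q\}<\infty$ and $\lim_{x\to0,x\in\mathbb{R}_q}\partial_q^nf(x)$ exists. $\mathcal{E}_{*,q}(\mathbb{R}_q)$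 is its subspace of even functions. $C(\alpha;q^2)=(1+q)\frac{\Gamma_{q^2}(\alpha+1)}{\Gamma_{q^2}(\frac12)\Gamma_{q^2}(\alpha+\frac12)}$, $W_\alpha(t;q^2)=\frac{(t^2q^2;q^2)_\infty}{(t^2q^{2\alpha+1};q^2)_\infty}$. $q$-Dunkl intertwining operator: for $f\in\mathcal{E}_q(\mathbb{R}_q)$, $V_{\alpha,q}(f)(x)=\frac{C(\alpha;q^2)}{2}\int_{-1}^1W_\alpha(t;q^2)(1+t)f(xt)d_qt$. $q$-Riemann–Liouville operator: for $f\in\mathcal{E}_{*,q}(\mathbb{R}_q)$, $R_{\alpha,q}(f)(x)=\frac{C(\alpha;q^2)}{2}\int_{-1}^1W_\alpha(t;q^2)f(xt)d_qt$. *)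

theory Defs
  imports "HOL-Analysis.Analysis"
begin

definition qpoch_inf :: "real \<Rightarrow> real \<Rightarrow> real" where
  "qpoch_inf a q = (\<Prod>k. 1 - a * q ^ k)"

(* The base is a parameter; it is instantiated with q^2 below. *)
definition q_Gamma :: "real \<Rightarrow> real \<Rightarrow> real" where
  "q_Gamma p x = qpoch_inf p p / qpoch_inf (p powr x) p * (1 - p) powr (1 - x)"

definition Rq :: "real \<Rightarrow> real set" where
  "Rq q = {q powi n | n :: int. True} \<union> {- (q powi n) | n :: int. True}"

(* Functions on Rq q are represented by total functions on the reals. For arguments
   in Rq q, everything below depends only on the values of the function on Rq q. *)

definition even_part :: "(real \<Rightarrow> complex) \<Rightarrow> real \<Rightarrow> complex" where
  "even_part f x = (f x + f (- x)) / 2"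

definition odd_part :: "(real \<Rightarrow> complex) \<Rightarrow> real \<Rightarrow> complex" where
  "odd_part f x = (f x - f (- x)) / 2"

definition jackson_int :: "real \<Rightarrow> real \<Rightarrow> (real \<Rightarrow> complex) \<Rightarrow> complex" where
  "jackson_int q a f =
     of_real ((1 - q) * a) * (\<Sum>n. of_real (q ^ n) * f (a * q ^ n))"

definition jackson_int_sym :: "real \<Rightarrow> (real \<Rightarrow> complex) \<Rightarrow> complex" where
  "jackson_int_sym q h =
     of_real (1 - q) * (\<Sum>n. of_real (q ^ n) * (h (q ^ n) + h (- (q ^ n))))"

(* Only meaningful for z \<noteq> 0. *)
definition q_deriv :: "real \<Rightarrow> (real \<Rightarrow> complex) \<Rightarrow> real \<Rightarrow> complex" where
  "q_deriv q f z =
     (f (inverse q * z) + f (- (inverse q * z)) - f (q * z) + f (- (q * z)) - 2 * f (- z))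
       / of_real (2 * (1 - q) * z)"

definition Eq_space :: "real \<Rightarrow> (real \<Rightarrow> complex) set" where
  "Eq_space q = {f.
     (\<forall>n. \<forall>a\<ge>0. bdd_above {cmod ((q_deriv q ^^ k) f x) | k x. k \<le> n \<and> x \<in> {-a..a} \<inter> Rq q}) \<and>
     (\<forall>n. \<exists>l. ((q_deriv q ^^ n) f \<longlongrightarrow> l) (at 0 within Rq q))}"

definition C_const :: "real \<Rightarrow> real \<Rightarrow> real" where
  "C_const \<alpha> q =
     (1 + q) * (q_Gamma (q\<^sup>2) (\<alpha> + 1) / (q_Gamma (q\<^sup>2) (1/2) * q_Gamma (q\<^sup>2) (\<alpha> + 1/2)))"

definition W_kernel :: "real \<Rightarrow> real \<Rightarrow> real \<Rightarrow> real" where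
  "W_kernel \<alpha> q t =
     qpoch_inf (t\<^sup>2 * q\<^sup>2) (q\<^sup>2) / qpoch_inf (t\<^sup>2 * q powr (2 * \<alpha> + 1)) (q\<^sup>2)"

definition V_op :: "real \<Rightarrow> real \<Rightarrow> (real \<Rightarrow> complex) \<Rightarrow> real \<Rightarrow> complex" where
  "V_op \<alpha> q f x =
     of_real (C_const \<alpha> q / 2) *
       jackson_int_sym q (\<lambda>t. of_real (W_kernel \<alpha> q t) * (1 + of_real t) * f (x * t))"

(* The operator is meant for even members of Eq_space q; the formula makes sense
   without that restriction. *)
definition R_op :: "real \<Rightarrow> real \<Rightarrow> (real \<Rightarrow> complex) \<Rightarrow> real \<Rightarrow> complex" where
  "R_op \<alpha> q f x =
     of_real (C_const \<alpha> q / 2) *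
       jackson_int_sym q (\<lambda>t. of_real (W_kernel \<alpha> q t) * f (x * t))"

definition I_op :: "real \<Rightarrow> (real \<Rightarrow> complex) \<Rightarrow> real \<Rightarrow> complex" where
  "I_op q g x = jackson_int q \<bar>q * x\<bar> g"

end

theory Submission
  imports Defs
begin

text \<open>
  Splitting \<open>f = f\<^sub>e + f\<^sub>o\<close>, the integrand of \<open>V\<close> at \<open>\<plusminus>q\<^sup>n\<close> contributes
  \<open>2 W(q\<^sup>n) (f\<^sub>e(x q\<^sup>n) + q\<^sup>n f\<^sub>o(x q\<^sup>n))\<close>. On an even function \<open>F\<close> the \<open>q\<close>-derivative is
  \<open>(F(x/q) - F(x)) / ((1-q) x)\<close>, and the Jackson integral telescopes under \<open>y \<mapsto> y/q\<close>:
  \<open>I(f\<^sub>o)(y/q) - I(f\<^sub>o)(y) = (1-q) y f\<^sub>o(y)\<close>. Taking \<open>y = x q\<^sup>n\<close> recovers the second summand term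
  by term; all series converge absolutely since \<open>f\<close> and \<open>W\<close> are bounded.
\<close>

lemma summable_power_mult_bounded:
  fixes w :: "nat \<Rightarrow> complex"
  assumes "0 \<le> q" "q < 1" "\<And>n. cmod (w n) \<le> B"
  shows "summable (\<lambda>n. of_real (q ^ n) * w n)"
proof (rule summable_comparison_test')
  show "summable (\<lambda>n. q ^ n * B)"
    using assms by (intro summable_mult2 summable_geometric) auto
  show "norm (of_real (q ^ n) * w n) \<le> q ^ n * B" if "n \<ge> 0" for n
    using assms by (auto simp: norm_mult norm_power intro!: mult_left_mono)
qed

lemma convergent_prod_qpoch:
  assumes "0 \<le> q" "q < (1::real)"
  shows "convergent_prod (\<lambda>k. 1 - a * q ^ k)"
proof -
  have "summable (\<lambda>k. norm ((1 - a * q ^ k) - 1))"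
    using assms by (simp add: abs_mult summable_mult summable_geometric)
  then show ?thesis
    by (intro abs_convergent_prod_imp_convergent_prod summable_imp_abs_convergent_prod)
qed

text \<open>The comparison is made factor by factor. The bound \<open>b \<le> 1\<close> keeps the
  factors of the smaller product nonnegative, without which factorwise inequalities would not pass
  to products.\<close>

lemma qpoch_inf_antimono:
  assumes "0 \<le> q" "q < 1" "a \<le> b" "b \<le> 1" "0 \<le> b"
  shows "qpoch_inf b q \<le> qpoch_inf a q"
  unfolding qpoch_inf_def
proof (rule has_prod_le)
  fix k
  have "q ^ k \<le> 1" using assms by (simp add: power_le_one)
  then have "b * q ^ k \<le> 1" using assms by (simp add: mult_le_one)
  moreover have "a * q ^ k \<le> b * q ^ k" using assms by (simp add: mult_right_mono)
  ultimately show "0 \<le> 1 - b * q ^ k \<and> 1 - b * q ^ k \<le> 1 - a * q ^ k" by simp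
qed (use assms in \<open>auto intro: convergent_prod_has_prod convergent_prod_qpoch\<close>)

lemma qpoch_inf_zero [simp]: "qpoch_inf 0 q = 1"
  by (simp add: qpoch_inf_def)

lemma qpoch_inf_nonneg:
  assumes "0 \<le> q" "q < 1" "a \<le> 1"
  shows "0 \<le> qpoch_inf a q"
proof -
  have "0 \<le> 1 - a * q ^ k" for k
    using mult_right_mono[OF assms(3), of "q ^ k"] assms power_le_one[of q k] by simp
  then show ?thesis unfolding qpoch_inf_def
    using convergent_prod_LIMSEQ[OF convergent_prod_qpoch[OF assms(1,2), of a]]
    by (rule LIMSEQ_prod_nonneg)
qed

lemma qpoch_inf_pos:
  assumes "0 \<le> q" "q < 1" "0 \<le> a" "a < 1"
  shows "0 < qpoch_inf a q"
  unfolding qpoch_inf_def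
proof (rule less_0_prodinf)
  show "0 < 1 - a * q ^ k" for k
    using mult_left_le[of "q ^ k" a] assms by (simp add: power_le_one le_less_trans)
qed (use assms convergent_prod_qpoch in auto)

text \<open>The numerator lies in [0,1] because its argument does. The denominator decreases as t^2
  grows, so for t^2 \<le> 1 it is at least its value at t^2 = 1, which is positive because \<alpha>
  > -1/2 gives \<open>q powr (2 * \<alpha> + 1) < 1\<close>.\<close>

lemma W_kernel_bounded:
  assumes "0 < q" "q < 1" "\<alpha> > - (1/2)"
  obtains B where "\<And>t. t\<^sup>2 \<le> 1 \<Longrightarrow> \<bar>W_kernel \<alpha> q t\<bar> \<le> B"
proof
  fix t :: real assume t: "t\<^sup>2 \<le> 1"
  let ?a = "q powr (2 * \<alpha> + 1)"
  have q2: "0 \<le> q\<^sup>2" "q\<^sup>2 < 1" using assms by (auto simp: power_less_one_iff)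
  have a: "0 \<le> ?a" "?a < 1" using assms powr_less_mono'[of q 0 "2 * \<alpha> + 1"] by auto
  have D: "0 < qpoch_inf ?a (q\<^sup>2)" using q2 a by (rule qpoch_inf_pos)
  have D': "qpoch_inf ?a (q\<^sup>2) \<le> qpoch_inf (t\<^sup>2 * ?a) (q\<^sup>2)"
    using q2 a t by (intro qpoch_inf_antimono) (auto simp: mult_left_le_one_le)
  have tq: "t\<^sup>2 * q\<^sup>2 \<le> 1" using t q2 by (simp add: mult_le_one)
  have N: "qpoch_inf (t\<^sup>2 * q\<^sup>2) (q\<^sup>2) \<le> 1"
    using qpoch_inf_antimono[OF q2, of 0 "t\<^sup>2 * q\<^sup>2"] tq by simp
  have N': "0 \<le> qpoch_inf (t\<^sup>2 * q\<^sup>2) (q\<^sup>2)"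
    using q2 tq by (rule qpoch_inf_nonneg)
  show "\<bar>W_kernel \<alpha> q t\<bar> \<le> 1 / qpoch_inf ?a (q\<^sup>2)"
    unfolding W_kernel_def using N N' D D' by (simp add: frac_le)
qed

lemma W_kernel_minus [simp]: "W_kernel \<alpha> q (- t) = W_kernel \<alpha> q t"
  by (simp add: W_kernel_def)

lemma Rq_minus: "x \<in> Rq q \<Longrightarrow> - x \<in> Rq q"
  by (auto simp: Rq_def)

lemma Rq_mult_power:
  assumes "0 < q" "x \<in> Rq q"
  shows "x * q ^ n \<in> Rq q"
proof -
  have "q powi m * q ^ n = q powi (m + int n)" for m
    using assms by (simp add: power_int_add)
  then show ?thesis using assms by (fastforce simp: Rq_def)
qed

lemma Rq_nonzero: "0 < q \<Longrightarrow> x \<in> Rq q \<Longrightarrow> x \<noteq> 0"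
  by (auto simp: Rq_def)

text \<open>This is the order-zero case of the bounds on iterated q-derivatives; with a =
  \<bar>x\<bar> it controls every sample of f taken by the three operators at x.\<close>

lemma Eq_space_bounded:
  assumes "f \<in> Eq_space q" "0 \<le> a"
  obtains M where "\<And>y. y \<in> Rq q \<Longrightarrow> \<bar>y\<bar> \<le> a \<Longrightarrow> cmod (f y) \<le> M"
proof -
  have "bdd_above {cmod ((q_deriv q ^^ k) f x) | k x. k \<le> 0 \<and> x \<in> {-a..a} \<inter> Rq q}"
    using assms(1)[unfolded Eq_space_def, THEN CollectD, THEN conjunct1, rule_format, of a 0] assms(2) .
  then obtain M where
    M: "\<And>c. c \<in> {cmod ((q_deriv q ^^ k) f x) | k x. k \<le> 0 \<and> x \<in> {-a..a} \<inter> Rq q} \<Longrightarrow> c \<le> M"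
    unfolding bdd_above_def by blast
  show ?thesis
  proof
    fix y assume "y \<in> Rq q" "\<bar>y\<bar> \<le> a"
    then show "cmod (f y) \<le> M" by (intro M) (auto intro!: exI[of _ 0] exI[of _ y])
  qed
qed

text \<open>For even F the two terms at q z cancel and the remaining ones double, which absorbs the
  2 in the denominator.\<close>

lemma q_deriv_even:
  assumes "\<And>y. F (- y) = F y"
  shows "q_deriv q F z = (F (z / q) - F z) / of_real ((1 - q) * z)"
proof -
  have "(2 * (F (z / q) - F z)) / (2 * of_real ((1 - q) * z)) =
      (F (z / q) - F z) / of_real ((1 - q) * z)"
    by (rule mult_divide_mult_cancel_left) simp
  then show ?thesis
    unfolding q_deriv_def assms by (simp add: divide_inverse_commute algebra_simps)
qed

text \<open>Kernel and F are both even, so the points q^n and -q^n contribute equally; the resulting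
  factor 2 removes the 1/2 in front of the integral.\<close>

lemma R_op_even:
  assumes "\<And>y. F (- y) = F y"
    and "summable (\<lambda>n. of_real (q ^ n) * (of_real (W_kernel \<alpha> q (q ^ n)) * F (x * q ^ n)))"
  shows "R_op \<alpha> q F x = of_real (C_const \<alpha> q * (1 - q)) *
           (\<Sum>n. of_real (q ^ n) * (of_real (W_kernel \<alpha> q (q ^ n)) * F (x * q ^ n)))"
proof -
  have "(\<lambda>n. of_real (q ^ n) * (of_real (W_kernel \<alpha> q (q ^ n)) * F (x * q ^ n) +
            of_real (W_kernel \<alpha> q (- (q ^ n))) * F (x * - (q ^ n)))) =
        (\<lambda>n. 2 * (of_real (q ^ n) * (of_real (W_kernel \<alpha> q (q ^ n)) * F (x * q ^ n))))"
    using assms(1) by (simp add: algebra_simps)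
  then show ?thesis
    using suminf_mult[OF assms(2), of 2] by (simp add: R_op_def jackson_int_sym_def)
qed

text \<open>The geometric sum 1/(1-q) cancels the factor 1-q of the Jackson integral.\<close>

lemma norm_I_op_le:
  assumes "0 \<le> q" "q < 1" "\<And>k. cmod (g (\<bar>q * y\<bar> * q ^ k)) \<le> M"
  shows "cmod (I_op q g y) \<le> \<bar>q * y\<bar> * M"
proof -
  have S: "summable (\<lambda>k. q ^ k * M)" using assms by (intro summable_mult2 summable_geometric) auto
  have "cmod (\<Sum>k. of_real (q ^ k) * g (\<bar>q * y\<bar> * q ^ k)) \<le> (\<Sum>k. q ^ k * M)"
    using assms by (intro norm_suminf_le[OF _ S]) (auto simp: norm_mult norm_power intro!: mult_left_mono)
  also have "\<dots> = M / (1 - q)" 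
    using assms by (simp add: suminf_mult2[symmetric] suminf_geometric summable_geometric)
  finally have "cmod (I_op q g y) \<le> ((1 - q) * \<bar>q * y\<bar>) * (M / (1 - q))"
    unfolding I_op_def jackson_int_def norm_mult norm_of_real using assms
    by (intro mult_mono) (auto simp: abs_mult)
  then show ?thesis using assms by simp
qed

text \<open>Because of the q in the upper limit of \<open>I_op\<close>, the two integrals run up to
  \<bar>y\<bar> and q\<bar>y\<bar>, so they differ exactly by the first term of the longer
  series.\<close>

lemma I_op_difference:
  assumes "0 < q" "q < 1" "\<And>y. g (- y) = - g y" "\<And>k. cmod (g (\<bar>y\<bar> * q ^ k)) \<le> M"
  shows "I_op q g (y / q) - I_op q g y = of_real ((1 - q) * y) * g y"
proof -
  have "summable (\<lambda>k. of_real (q ^ k) * g (\<bar>y\<bar> * q ^ k))"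
    using assms by (intro summable_power_mult_bounded) auto
  from suminf_split_head[OF this]
  have "(\<Sum>k. of_real (q ^ k) * g (\<bar>y\<bar> * q ^ k)) =
     g \<bar>y\<bar> + (\<Sum>k. of_real q * (of_real (q ^ k) * g (\<bar>q * y\<bar> * q ^ k)))"
    using assms by (simp add: abs_mult algebra_simps)
  \<comment> \<open>The sample points here are \<bar>y\<bar> q^(k+1), so convergence uses the bound
    on g at index \<open>Suc k\<close>.\<close>
  also have "(\<Sum>k. of_real q * (of_real (q ^ k) * g (\<bar>q * y\<bar> * q ^ k))) =
      of_real q * (\<Sum>k. of_real (q ^ k) * g (\<bar>q * y\<bar> * q ^ k))"
    using assms by (intro suminf_mult summable_power_mult_bounded[where B = M])
      (use assms(4)[of "Suc _"] in \<open>auto simp: abs_mult algebra_simps\<close>)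
  finally have "I_op q g (y / q) - I_op q g y = of_real ((1 - q) * \<bar>y\<bar>) * g \<bar>y\<bar>"
    using assms unfolding I_op_def jackson_int_def by (simp add: abs_mult algebra_simps)
  also have "\<dots> = of_real ((1 - q) * y) * g y"
    using assms by (auto simp: abs_if)
  finally show ?thesis .
qed

theorem theorem6:
  fixes q \<alpha> :: real and f :: "real \<Rightarrow> complex" and x :: real
  assumes "0 < q" and "q < 1"
    and "\<exists>k::int. ln (1 - q) / ln q = 2 * of_int k"
    and "\<alpha> > - (1/2)"
    and "f \<in> Eq_space q"
    and "x \<in> Rq q"
  shows "V_op \<alpha> q f x =
           R_op \<alpha> q (even_part f) x + q_deriv q (R_op \<alpha> q (I_op q (odd_part f))) x"
proof -
  define g where "g = odd_part f"
  define e where "e = even_part f"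
  define W where "W n = complex_of_real (W_kernel \<alpha> q (q ^ n))" for n
  define K where "K = complex_of_real (C_const \<alpha> q * (1 - q))"
  define F where "F = R_op \<alpha> q (I_op q g)"
  \<comment> \<open>Common summand of all series below; \<open>h\<close> is the only part that
    varies, and its boundedness alone gives convergence.\<close>
  define trm where "trm h n = of_real (q ^ n) * (W n * h n)" for h n
  have g_odd: "g (- y) = - g y" for y by (simp add: g_def odd_part_def divide_simps)
  have e_even: "e (- y) = e y" for y by (simp add: e_def even_part_def add.commute)
  have f_eq: "f y = e y + g y" for y
    by (simp add: e_def g_def even_part_def odd_part_def field_simps)
  have x0: "x \<noteq> 0" using Rq_nonzero assms by blast
  obtain B where B: "\<And>n. cmod (W n) \<le> B"
  proof -
    obtain B where "\<And>t. t\<^sup>2 \<le> 1 \<Longrightarrow> \<bar>W_kernel \<alpha> q t\<bar> \<le> B"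
      using W_kernel_bounded assms(1,2,4) by metis
    moreover have "(q ^ n)\<^sup>2 \<le> 1" for n using assms by (simp add: power_le_one)
    ultimately show ?thesis by (intro that[of B]) (simp add: W_def)
  qed
  have B0: "0 \<le> B" using B[of 0] norm_ge_zero order_trans by blast
  have summable_trm: "summable (trm h)" if "\<And>n. cmod (h n) \<le> M" for h M
    unfolding trm_def
    by (rule summable_power_mult_bounded[where B = "B * M"])
      (use assms B B0 that in \<open>auto simp: norm_mult intro!: mult_mono\<close>)
  obtain M where M: "\<And>y. y \<in> Rq q \<Longrightarrow> \<bar>y\<bar> \<le> \<bar>x\<bar> \<Longrightarrow> cmod (f y) \<le> M"
    using Eq_space_bounded[OF assms(5), of "\<bar>x\<bar>"] by auto
  have fM: "cmod (f (x * q ^ n)) \<le> M" "cmod (f (- (x * q ^ n))) \<le> M" for n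
    using assms by (auto intro!: M Rq_minus Rq_mult_power simp: abs_mult mult_left_le power_le_one)
  have eM: "cmod (e (x * q ^ n)) \<le> M" for n
    using fM[of n] norm_triangle_ineq[of "f (x * q ^ n)" "f (- (x * q ^ n))"]
    by (simp add: e_def even_part_def norm_divide)
  have gM: "cmod (g (x * q ^ n)) \<le> M" for n
    using fM[of n] norm_triangle_ineq4[of "f (x * q ^ n)" "f (- (x * q ^ n))"]
    by (simp add: g_def odd_part_def norm_divide)
  \<comment> \<open>\<open>I_op\<close> samples g at positive points only, so for negative x the
    bound is carried over by oddness.\<close>
  have gM': "cmod (g (\<bar>x\<bar> * q ^ n)) \<le> M" for n
    using gM[of n] g_odd[of "x * q ^ n"] by (cases "x \<ge> 0") (auto simp: abs_if)
  have M0: "0 \<le> M" using gM[of 0] norm_ge_zero order_trans by blast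
  \<comment> \<open>Although x/q lies outside the range covered by M, the upper limit is \<bar>q
    (x/q) q^n\<bar> = \<bar>x\<bar> q^n, so g is only sampled where M applies.\<close>
  have IM: "cmod (I_op q g (x / q * q ^ n)) \<le> \<bar>x\<bar> * M" for n
  proof -
    have "cmod (I_op q g (x / q * q ^ n)) \<le> \<bar>q * (x / q * q ^ n)\<bar> * M"
    proof (rule norm_I_op_le)
      show "cmod (g (\<bar>q * (x / q * q ^ n)\<bar> * q ^ k)) \<le> M" for k
        using gM'[of "n + k"] assms by (simp add: abs_mult power_add mult.assoc)
    qed (use assms in auto)
    also have "\<dots> \<le> \<bar>x\<bar> * M"
      using assms M0 by (intro mult_right_mono) (auto simp: abs_mult mult_left_le power_le_one)
    finally show ?thesis .
  qed
  have IM': "cmod (I_op q g (x * q ^ n)) \<le> \<bar>x\<bar> * M" for n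
    using IM[of "Suc n"] assms by simp
  have I_diff: "I_op q g (x / q * q ^ n) - I_op q g (x * q ^ n) =
      of_real ((1 - q) * x) * (of_real (q ^ n) * g (x * q ^ n))" for n
  proof -
    have "cmod (g (\<bar>x * q ^ n\<bar> * q ^ k)) \<le> M" for k
      using gM'[of "n + k"] assms by (simp add: abs_mult power_add mult.assoc)
    then show ?thesis
      using I_op_difference[of q g "x * q ^ n" M] assms g_odd by (simp add: mult.assoc)
  qed
  have R_eq: "R_op \<alpha> q h y = K * (\<Sum>n. trm (\<lambda>n. h (y * q ^ n)) n)"
    if "\<And>y. h (- y) = h y" "\<And>n. cmod (h (y * q ^ n)) \<le> M'" for h y M'
    using R_op_even[of h q \<alpha> y] summable_trm[of "\<lambda>n. h (y * q ^ n)" M'] that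
    unfolding trm_def K_def W_def by blast
  have I_even: "I_op q g (- y) = I_op q g y" for y by (simp add: I_op_def)
  \<comment> \<open>Series for F at x/q and at x, the two points used by the q-derivative of an even
    function.\<close>
  note F_eq = R_eq[OF I_even IM, folded F_def] R_eq[OF I_even IM', folded F_def]
  have F_even: "F (- y) = F y" for y
    by (simp add: F_def R_op_def I_op_def)
  have sg: "summable (trm (\<lambda>n. of_real (q ^ n) * g (x * q ^ n)))"
  proof (rule summable_trm)
    show "cmod (of_real (q ^ n) * g (x * q ^ n)) \<le> M" for n
      using gM[of n] assms mult_mono[of "q ^ n" 1 "cmod (g (x * q ^ n))" M]
      by (simp add: norm_mult norm_power power_le_one)
  qed
  have "F (x / q) - F x = K * (\<Sum>n. trm (\<lambda>n. I_op q g (x / q * q ^ n)) n - 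
      trm (\<lambda>n. I_op q g (x * q ^ n)) n)"
    unfolding F_eq right_diff_distrib[symmetric]
    by (subst suminf_diff[OF summable_trm[OF IM] summable_trm[OF IM']]) simp
  also have "(\<lambda>n. trm (\<lambda>n. I_op q g (x / q * q ^ n)) n - trm (\<lambda>n. I_op q g (x * q ^ n)) n) =
      (\<lambda>n. of_real ((1 - q) * x) * trm (\<lambda>n. of_real (q ^ n) * g (x * q ^ n)) n)"
    unfolding trm_def right_diff_distrib[symmetric] I_diff by (simp add: mult_ac)
  also have "(\<Sum>n. of_real ((1 - q) * x) * trm (\<lambda>n. of_real (q ^ n) * g (x * q ^ n)) n) =
      of_real ((1 - q) * x) * (\<Sum>n. trm (\<lambda>n. of_real (q ^ n) * g (x * q ^ n)) n)"
    by (rule suminf_mult[OF sg])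
  \<comment> \<open>The factor (1-q) x pulled out of the sum is the denominator in
    \<open>q_deriv_even\<close>; it cancels since x and 1-q are nonzero.\<close>
  finally have deriv: "q_deriv q F x = K * (\<Sum>n. trm (\<lambda>n. of_real (q ^ n) * g (x * q ^ n)) n)"
    using q_deriv_even[of F q x, OF F_even] x0 assms by simp
  have Re: "R_op \<alpha> q e x = K * (\<Sum>n. trm (\<lambda>n. e (x * q ^ n)) n)"
    using e_even eM by (rule R_eq)
  \<comment> \<open>With t = q^n, parity gives (1+t) f(xt) + (1-t) f(-xt) = 2 (e(xt) + t
    g(xt)).\<close>
  have "(\<lambda>n. of_real (q ^ n) *
      (of_real (W_kernel \<alpha> q (q ^ n)) * (1 + of_real (q ^ n)) * f (x * q ^ n) +
       of_real (W_kernel \<alpha> q (- (q ^ n))) * (1 + of_real (- (q ^ n))) * f (x * - (q ^ n)))) =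
     (\<lambda>n. 2 * (trm (\<lambda>n. e (x * q ^ n)) n + trm (\<lambda>n. of_real (q ^ n) * g (x * q ^ n)) n))"
    by (simp add: trm_def W_def f_eq e_even g_odd algebra_simps)
  then have "V_op \<alpha> q f x = of_real (C_const \<alpha> q / 2) * (of_real (1 - q) *
     (\<Sum>n. 2 * (trm (\<lambda>n. e (x * q ^ n)) n + trm (\<lambda>n. of_real (q ^ n) * g (x * q ^ n)) n)))"
    unfolding V_op_def jackson_int_sym_def by simp
  also have "\<dots> = K * (\<Sum>n. trm (\<lambda>n. e (x * q ^ n)) n + trm (\<lambda>n. of_real (q ^ n) * g (x * q ^ n)) n)"
    by (subst suminf_mult[OF summable_add[OF summable_trm[OF eM] sg]]) (simp add: K_def)
  also have "\<dots> = R_op \<alpha> q e x + q_deriv q F x"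
    unfolding deriv Re by (subst suminf_add[OF summable_trm[OF eM] sg, symmetric]) (simp add: distrib_left)
  finally show ?thesis by (simp add: F_def e_def g_def)
qed

end
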